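(* Let $M=\mathbb{R}^n$, let $\Gamma$ be a closed cone in $\dot T^*M$, let $Q=[-1,1]^n$ and let $K\subset Q$ be compact. With the sets $q_{j,m}$, $C_{j,m,\ell}$, $UT^*M|_K$ and $U\Gamma_K$ defined in the context, and with unions taken over all integers $j\ge 0$, all $m\in\mathbb{Z}^n\cap 2^jQ$ and all integers $\ell\ge 1$, one has $$\bigcup_{j,m,\ell} q_{j,m}\times C_{j,m,\ell}=UT^*M|_K\setminus U\Gamma_K,$$ and, denoting $V_{j,m,\ell}=\{k\in\mathbb{R}^n\setminus\{0\} : k/|k|\in C_{j,m,\ell}\}$, $$\bigcup_{j,m,\ell} q_{j,m}\times V_{j,m,\ell}=(\dot T^*M\setminus\Gamma)|_K.$$
   Context: $\dot T^*\mathbb{R}^n=\{(x;\xi)\in\mathbb{R}^n\times\mathbb{R}^n : \xi\neq 0\}$; a cone in it is a subset stable under $(x;\xi)\mapsto(x;\lambda\xi)$ for every $\lambda>0$; closed means closed in $\dot T^*\mathbb{R}^n$. $S^{n-1}$ is the Euclidean unit sphere of $\mathbb{R}^n$. $UT^*M=\{(x;k)\in T^*M : |k|=1\}=\mathbb{R}^n\times S^{n-1}$ is the unit cotangent bundle, and the subscript $|_K$ denotes restriction to base points $x\in K$, so that $UT^*M|_K=K\times S^{n-1}$ and $(\dot T^*M\setminus\Gamma)|_K=\{(x;k)\in\dot T^*M : x\in K,\ (x;k)\notin\Gamma\}$. $U\Gamma_K=\{(x;k)\in\Gamma : x\in K,\ |k|=1\}$. $d_\infty(x,y)=\sup_{1\le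 i\le n}|x_i-y_i|$ on $\mathbb{R}^n$, restricted also to $S^{n-1}$; the distance from a point to the empty set is taken to be $+\infty$. $q_{j,m}=\{y\in\mathbb{R}^n : d_\infty(2^{-j}m,y)\le 2^{-j}\}$ is the closed cube with center $2^{-j}m$. $F_{j,m}=q_{j,m}\times S^{n-1}$, $\overline{\pi}(x;k)=k$, and $C_{j,m,\ell}=\{\eta\in S^{n-1} : d_\infty(\overline{\pi}(F_{j,m}\cap U\Gamma_K),\eta)\ge 1/\ell\}$.
   Formalization: Both left-hand unions are restricted to base points x in K, since cubes q_{j,m} can stick out of K: for Γ empty, K=Q, j=0, m=(1,…,1), the point x=(2,…,2) lies in q_{0,m} but not in K, so the equalities as written fail. *)

theory Defs
  imports "HOL-Analysis.Analysis"
begin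

text \<open>The cotangent bundle of \<open>\<real>\<^sup>n\<close> is the product \<open>\<real>\<^sup>n \<times> \<real>\<^sup>n\<close>, where \<open>n = CARD('n)\<close> is
  arbitrary.  Points are pairs (base point, covector).\<close>

definition T_dot :: "((real ^ 'n) \<times> (real ^ 'n)) set" where
  "T_dot = {(x, \<xi>). \<xi> \<noteq> 0}"

definition UT :: "((real ^ 'n) \<times> (real ^ 'n)) set" where
  "UT = UNIV \<times> sphere 0 1"

text \<open>Only positive factors are allowed, unlike in the library's \<^const>\<open>conic\<close>;
  closedness is relative to \<open>T_dot\<close>.\<close>

definition closed_cone :: "((real ^ 'n) \<times> (real ^ 'n)) set \<Rightarrow> bool" where
  "closed_cone \<Gamma> \<longleftrightarrow>
     \<Gamma> \<subseteq> T_dot \<and>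
     (\<forall>x \<xi>. \<forall>t>0. (x, \<xi>) \<in> \<Gamma> \<longrightarrow> (x, t *\<^sub>R \<xi>) \<in> \<Gamma>) \<and>
     closedin (top_of_set T_dot) \<Gamma>"

definition over_base ::
  "((real ^ 'n) \<times> (real ^ 'n)) set \<Rightarrow> (real ^ 'n) set \<Rightarrow> ((real ^ 'n) \<times> (real ^ 'n)) set"
  (infixl "over'_base" 75) where
  "A over_base K = {(x, k) \<in> A. x \<in> K}"

definition U_cone ::
  "((real ^ 'n) \<times> (real ^ 'n)) set \<Rightarrow> (real ^ 'n) set \<Rightarrow> ((real ^ 'n) \<times> (real ^ 'n)) set" where
  "U_cone \<Gamma> K = {(x, k) \<in> \<Gamma>. x \<in> K \<and> norm k = 1}"

definition Q_cube :: "(real ^ 'n) set" where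
  "Q_cube = {x. \<forall>i. -1 \<le> x $ i \<and> x $ i \<le> 1}"

definition int_lattice :: "(real ^ 'n) set" where
  "int_lattice = {m. \<forall>i. m $ i \<in> \<int>}"

definition centers :: "nat \<Rightarrow> (real ^ 'n) set" where
  "centers j = int_lattice \<inter> (\<lambda>x. 2 ^ j *\<^sub>R x) ` Q_cube"

definition d_inf :: "real ^ 'n \<Rightarrow> real ^ 'n \<Rightarrow> real" where
  "d_inf x y = (SUP i. \<bar>x $ i - y $ i\<bar>)"

text \<open>The values are extended reals so that the distance to the empty set is \<open>\<infinity>\<close>, the
  infimum of the empty set; \<^const>\<open>infdist\<close> would give 0.\<close>

definition d_inf_set :: "(real ^ 'n) set \<Rightarrow> real ^ 'n \<Rightarrow> ereal" where
  "d_inf_set A y = (INF x\<in>A. ereal (d_inf x y))"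

definition q :: "nat \<Rightarrow> real ^ 'n \<Rightarrow> (real ^ 'n) set" where
  "q j m = {y. d_inf ((1 / 2 ^ j) *\<^sub>R m) y \<le> 1 / 2 ^ j}"

definition F :: "nat \<Rightarrow> real ^ 'n \<Rightarrow> ((real ^ 'n) \<times> (real ^ 'n)) set" where
  "F j m = q j m \<times> sphere 0 1"

definition C ::
  "((real ^ 'n) \<times> (real ^ 'n)) set \<Rightarrow> (real ^ 'n) set \<Rightarrow> nat \<Rightarrow> real ^ 'n \<Rightarrow> nat \<Rightarrow> (real ^ 'n) set" where
  "C \<Gamma> K j m l =
     {\<eta> \<in> sphere 0 1. d_inf_set (snd ` (F j m \<inter> U_cone \<Gamma> K)) \<eta> \<ge> ereal (1 / real l)}"

definition V ::
  "((real ^ 'n) \<times> (real ^ 'n)) set \<Rightarrow> (real ^ 'n) set \<Rightarrow> nat \<Rightarrow> real ^ 'n \<Rightarrow> nat \<Rightarrow> (real ^ 'n) set" where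
  "V \<Gamma> K j m l = {k. k \<noteq> 0 \<and> (1 / norm k) *\<^sub>R k \<in> C \<Gamma> K j m l}"

text \<open>In general the cubes \<open>q j m\<close> stick out of \<open>K\<close>.  The union of the products
  \<open>q j m \<times> C \<Gamma> K j m l\<close> then contains points whose base point is not in \<open>K\<close>, and it equals \<open>UT over_base K - U_cone \<Gamma> K\<close>
  only after restriction to base points in \<open>K\<close>.  The same holds for \<open>V\<close>.  The lemma below
  shows that the restriction cannot be dropped, in any dimension, even for \<open>K = Q_cube\<close>.\<close>

lemma unrestricted_unions_differ:
  fixes K \<Gamma> :: "_ set"
  defines "K \<equiv> (Q_cube :: (real ^ 'n) set)" and "\<Gamma> \<equiv> ({} :: ((real ^ 'n) \<times> (real ^ 'n)) set)"
  shows "closed_cone \<Gamma>" "compact K" "K \<subseteq> Q_cube"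
    "(\<Union>j. \<Union>m\<in>centers j. \<Union>l\<in>{1..}. q j m \<times> C \<Gamma> K j m l) \<noteq> UT over_base K - U_cone \<Gamma> K"
    "(\<Union>j. \<Union>m\<in>centers j. \<Union>l\<in>{1..}. q j m \<times> V \<Gamma> K j m l) \<noteq> (T_dot - \<Gamma>) over_base K"
proof -
  show "closed_cone \<Gamma>" by (simp add: closed_cone_def \<Gamma>_def)
  have "K = cbox (vec (-1)) (vec 1)"
    by (auto simp: K_def Q_cube_def mem_box_cart)
  then show "compact K" by (simp add: compact_cbox)
  show "K \<subseteq> Q_cube" by (simp add: K_def)
  define x where "x = (vec 2 :: real ^ 'n)"
  define e where "e = (axis undefined 1 :: real ^ 'n)"
  have e: "norm e = 1" "e \<noteq> 0" by (auto simp: e_def norm_axis_1 axis_eq_0_iff)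
  have xK: "x \<notin> K" by (simp add: x_def K_def Q_cube_def)
  have m: "vec 1 \<in> (centers 0 :: (real ^ 'n) set)"
    by (simp add: centers_def int_lattice_def Q_cube_def)
  have xq: "x \<in> q 0 (vec 1)" by (simp add: q_def x_def d_inf_def)
  have eC: "e \<in> C \<Gamma> K 0 (vec 1) 1"
    by (simp add: C_def U_cone_def \<Gamma>_def d_inf_set_def e top_ereal_def)
  have eV: "e \<in> V \<Gamma> K 0 (vec 1) 1" using eC e by (simp add: V_def)
  have "(x, e) \<in> (\<Union>j. \<Union>m\<in>centers j. \<Union>l\<in>{1..}. q j m \<times> C \<Gamma> K j m l)"
    using m xq eC by (intro UN_I[of 0] UN_I[of "vec 1"] UN_I[of 1]) auto
  then show "(\<Union>j. \<Union>m\<in>centers j. \<Union>l\<in>{1..}. q j m \<times> C \<Gamma> K j m l) \<noteq> UT over_base K - U_cone \<Gamma> K"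
    using xK unfolding over_base_def by blast
  have "(x, e) \<in> (\<Union>j. \<Union>m\<in>centers j. \<Union>l\<in>{1..}. q j m \<times> V \<Gamma> K j m l)"
    using m xq eV by (intro UN_I[of 0] UN_I[of "vec 1"] UN_I[of 1]) auto
  then show "(\<Union>j. \<Union>m\<in>centers j. \<Union>l\<in>{1..}. q j m \<times> V \<Gamma> K j m l) \<noteq> (T_dot - \<Gamma>) over_base K"
    using xK unfolding over_base_def by blast
qed

end

theory Submission
  imports Defs
begin

text \<open>A point \<open>(x, \<eta>)\<close> of the unit bundle over \<open>K\<close> that is not in \<open>\<Gamma>\<close> has a neighbourhood, for the
  \<open>d\<^sub>\<infinity>\<close> distance in both variables, of some radius \<open>\<epsilon>\<close> that misses \<open>\<Gamma>\<close>. A dyadic cube that contains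
  \<open>x\<close> and has side \<open>2 / 2\<^sup>j < \<epsilon>\<close> then lies in this neighbourhood, so every unit covector
  of \<open>\<Gamma>\<close> over it has distance at least \<open>\<epsilon>\<close> from \<open>\<eta>\<close>. Conversely, a covector of \<open>\<Gamma>\<close> over \<open>x \<in> q j m\<close>
  has distance \<open>0\<close> from the set that defines \<open>C\<close>. The statement on \<open>V\<close> follows by normalising covectors.\<close>

lemma d_inf_le_iff: "d_inf x y \<le> c \<longleftrightarrow> (\<forall>i. \<bar>x $ i - y $ i\<bar> \<le> c)"
  unfolding d_inf_def by (subst cSUP_le_iff) auto

lemma component_le_d_inf: "\<bar>x $ i - y $ i\<bar> \<le> d_inf x y"
  using d_inf_le_iff[of x y "d_inf x y"] by blast

lemma d_inf_commute: "d_inf x y = d_inf y x"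
  by (simp add: d_inf_def abs_minus_commute)

lemma d_inf_triangle: "d_inf x z \<le> d_inf x y + d_inf y z"
  unfolding d_inf_le_iff
proof
  fix i
  show "\<bar>x $ i - z $ i\<bar> \<le> d_inf x y + d_inf y z"
    using component_le_d_inf[of x i y] component_le_d_inf[of y i z] by linarith
qed

lemma d_inf_self [simp]: "d_inf x x = 0"
  by (simp add: d_inf_def)

text \<open>Lets Euclidean balls, which define closedness, be replaced by the \<open>d_inf\<close>
  balls that define cubes. The factor comes from the l1 norm, a sum of \<open>CARD('n)\<close>
  terms.\<close>

lemma dist_le_d_inf:
  fixes x y :: "real ^ 'n"
  shows "dist x y \<le> real CARD('n) * d_inf x y"
proof -
  have "dist x y \<le> (\<Sum>i\<in>UNIV. \<bar>(x - y) $ i\<bar>)"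
    unfolding dist_norm by (rule norm_le_l1_cart)
  also have "\<dots> \<le> real CARD('n) * d_inf x y"
    by (rule sum_bounded_above) (simp add: component_le_d_inf)
  finally show ?thesis .
qed

lemma q_diameter:
  assumes "x \<in> q j m" and "y \<in> q j m"
  shows "d_inf x y \<le> 2 / 2 ^ j"
  using assms d_inf_triangle[of x y "(1 / 2 ^ j) *\<^sub>R m"]
  by (simp add: q_def d_inf_commute)

lemma ex_dyadic_cube:
  assumes "x \<in> Q_cube"
  shows "\<exists>m\<in>centers j. x \<in> q j m"
proof
  \<comment> \<open>Rounding down the scaled point keeps it in the cube
    \<open>2 ^ j *\<^sub>R Q_cube\<close>, since the lower bound \<open>- (2 ^ j)\<close> is itself
    an integer. Each coordinate moves by less than 1, hence by less than \<open>1 / 2 ^ j\<close>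
    after scaling back.\<close>
  define m where "m = (\<chi> i. real_of_int \<lfloor>2 ^ j * x $ i\<rfloor>)"
  have "-1 \<le> m $ i / 2 ^ j \<and> m $ i / 2 ^ j \<le> 1" for i
  proof -
    have x: "-1 \<le> x $ i" "x $ i \<le> 1"
      using assms by (auto simp: Q_cube_def)
    have "- (2 ^ j) \<le> 2 ^ j * x $ i"
      using mult_left_mono[OF x(1), of "2 ^ j"] by simp
    then have "- (2 ^ j) \<le> \<lfloor>2 ^ j * x $ i\<rfloor>"
      by (simp add: le_floor_iff)
    then have "real_of_int (- (2 ^ j)) \<le> real_of_int \<lfloor>2 ^ j * x $ i\<rfloor>"
      by (simp only: of_int_le_iff)
    moreover have "real_of_int \<lfloor>2 ^ j * x $ i\<rfloor> \<le> 2 ^ j"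
      by (rule order_trans[OF of_int_floor_le]) (simp add: x)
    ultimately show ?thesis
      by (simp add: m_def field_simps)
  qed
  then have "(1 / 2 ^ j) *\<^sub>R m \<in> Q_cube"
    by (simp add: Q_cube_def)
  moreover have "m = 2 ^ j *\<^sub>R ((1 / 2 ^ j) *\<^sub>R m)"
    by simp
  ultimately have "m \<in> (\<lambda>x. 2 ^ j *\<^sub>R x) ` Q_cube"
    by blast
  then show "m \<in> centers j"
    by (simp add: centers_def int_lattice_def m_def)
  have "\<bar>m $ i / 2 ^ j - x $ i\<bar> \<le> 1 / 2 ^ j" for i
  proof -
    have "\<bar>m $ i - 2 ^ j * x $ i\<bar> \<le> 1"
      unfolding m_def by simp linarith
    then have "\<bar>m $ i - 2 ^ j * x $ i\<bar> / 2 ^ j \<le> 1 / 2 ^ j"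
      by (simp add: divide_right_mono)
    moreover have "m $ i / 2 ^ j - x $ i = (m $ i - 2 ^ j * x $ i) / 2 ^ j"
      by (simp add: field_simps)
    ultimately show ?thesis
      by simp
  qed
  then show "x \<in> q j m"
    by (simp add: q_def d_inf_le_iff)
qed

lemma closed_cone_avoid:
  fixes \<Gamma> :: "((real ^ 'n) \<times> (real ^ 'n)) set"
  assumes "closed_cone \<Gamma>" and "\<eta> \<noteq> 0" and "(x, \<eta>) \<notin> \<Gamma>"
  obtains \<epsilon> where "\<epsilon> > 0"
    and "\<And>y k. d_inf x y < \<epsilon> \<Longrightarrow> d_inf \<eta> k < \<epsilon> \<Longrightarrow> (y, k) \<notin> \<Gamma>"
proof -
  \<comment> \<open>Closedness of \<open>\<Gamma>\<close> is relative to \<open>T_dot\<close>, so a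
    closed set \<open>S\<close> of the whole space replaces it. As \<open>\<eta> \<noteq> 0\<close>
    puts the point in \<open>T_dot\<close>, the point lies outside \<open>S\<close>.\<close>
  obtain S where S: "closed S" "\<Gamma> = T_dot \<inter> S"
    using assms(1) by (auto simp: closed_cone_def closedin_closed)
  then have "(x, \<eta>) \<in> - S" "open (- S)"
    using assms by (auto simp: T_dot_def)
  then obtain e where e: "e > 0" "ball (x, \<eta>) e \<subseteq> - S"
    by (meson open_contains_ball)
  define n where "n = real CARD('n)"
  have n: "n > 0"
    by (simp add: n_def)
  show thesis
  proof
    \<comment> \<open>With this radius each factor contributes a Euclidean distance below
      \<open>e / 2\<close>, and the product distance is at most the sum of the two.\<close>
    show "e / (2 * n) > 0"
      using e n by simp
    fix y k
    assume "d_inf x y < e / (2 * n)" "d_inf \<eta> k < e / (2 * n)"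
    then have "n * d_inf x y < e / 2" "n * d_inf \<eta> k < e / 2"
      using n by (simp_all add: field_simps)
    then have "dist x y + dist \<eta> k < e"
      using dist_le_d_inf[of x y] dist_le_d_inf[of \<eta> k] by (simp add: n_def)
    then have "dist (x, \<eta>) (y, k) < e"
      using sqrt_sum_squares_le_sum[of "dist x y" "dist \<eta> k"] by (simp add: dist_Pair_Pair)
    then show "(y, k) \<notin> \<Gamma>"
      using e S by auto
  qed
qed

lemma C_subset:
  assumes "l \<ge> 1" and "x \<in> q j m" and "\<eta> \<in> C \<Gamma> K j m l" and "x \<in> K"
  shows "norm \<eta> = 1" and "(x, \<eta>) \<notin> \<Gamma>"
proof -
  show norm: "norm \<eta> = 1"
    using assms by (simp add: C_def)
  show "(x, \<eta>) \<notin> \<Gamma>"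
  proof
    assume "(x, \<eta>) \<in> \<Gamma>"
    \<comment> \<open>Here \<open>x \<in> K\<close> enters: \<open>U_cone\<close> records covectors
      of \<open>\<Gamma>\<close> over \<open>K\<close> only.\<close>
    then have "(x, \<eta>) \<in> F j m \<inter> U_cone \<Gamma> K"
      using assms norm by (simp add: F_def U_cone_def)
    then have "\<eta> \<in> snd ` (F j m \<inter> U_cone \<Gamma> K)"
      by force
    then have "d_inf_set (snd ` (F j m \<inter> U_cone \<Gamma> K)) \<eta> \<le> ereal (d_inf \<eta> \<eta>)"
      unfolding d_inf_set_def by (rule INF_lower)
    moreover have "ereal (1 / real l) \<le> d_inf_set (snd ` (F j m \<inter> U_cone \<Gamma> K)) \<eta>"
      using assms(3) by (simp add: C_def)
    ultimately have "ereal (1 / real l) \<le> ereal (d_inf \<eta> \<eta>)"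
      by (rule order_trans[rotated])
    \<comment> \<open>The right side is 0, while \<open>l \<ge> 1\<close> makes the left side
      positive; \<open>l = 0\<close> would give \<open>1 / real l = 0\<close> and no
      contradiction.\<close>
    then show False
      using assms(1) by simp
  qed
qed

lemma ex_cube_C:
  assumes "closed_cone \<Gamma>" and "x \<in> Q_cube" and "norm \<eta> = 1" and "(x, \<eta>) \<notin> \<Gamma>"
  obtains j m l where "m \<in> centers j" and "l \<ge> 1" and "x \<in> q j m" and "\<eta> \<in> C \<Gamma> K j m l"
proof -
  have "\<eta> \<noteq> 0"
    using assms(3) by auto
  then obtain \<epsilon> where \<epsilon>: "\<epsilon> > 0"
    "\<And>y k. d_inf x y < \<epsilon> \<Longrightarrow> d_inf \<eta> k < \<epsilon> \<Longrightarrow> (y, k) \<notin> \<Gamma>"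
    using closed_cone_avoid[OF assms(1) _ assms(4)] by blast
  obtain l where l: "l \<noteq> 0" "inverse (real l) < \<epsilon>"
    using \<epsilon>(1) real_arch_inverse by blast
  obtain j where "(1 / 2) ^ j < \<epsilon> / 2"
    using real_arch_pow_inv[of "\<epsilon> / 2" "1 / 2"] \<epsilon>(1) by auto
  then have j: "2 / 2 ^ j < \<epsilon>"
    by (simp add: power_one_over)
  obtain m where m: "m \<in> centers j" "x \<in> q j m"
    using ex_dyadic_cube[OF assms(2)] by blast
  have "ereal (1 / real l) \<le> ereal (d_inf k \<eta>)" if "(y, k) \<in> F j m \<inter> U_cone \<Gamma> K" for y k
  proof -
    have "d_inf x y < \<epsilon>"
      using that q_diameter[OF m(2), of y] j by (auto simp: F_def)
    \<comment> \<open>By contraposition: a covector \<open>k\<close> closer to \<open>\<eta>\<close>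
      would make \<open>(y, k)\<close> a point of the neighbourhood that misses
      \<open>\<Gamma>\<close>.\<close>
    then have "\<epsilon> \<le> d_inf k \<eta>"
      using that \<epsilon>(2)[of y k] by (auto simp: U_cone_def d_inf_commute not_less[symmetric])
    then show ?thesis
      using l by (simp add: inverse_eq_divide)
  qed
  \<comment> \<open>If no covector of \<open>\<Gamma>\<close> lies over the part of the cube in
    \<open>K\<close>, the infimum is \<infinity> and the bound still holds.\<close>
  then have "ereal (1 / real l) \<le> d_inf_set (snd ` (F j m \<inter> U_cone \<Gamma> K)) \<eta>"
    unfolding d_inf_set_def by (intro INF_greatest) auto
  then have "\<eta> \<in> C \<Gamma> K j m l"
    using assms(3) by (simp add: C_def)
  then show thesis
    using that[of m j l] m l by simp
qed

text \<open>Conic stability is used twice, with the mutually inverse positive factors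
  \<open>1 / norm k\<close> and \<open>norm k\<close>.\<close>

lemma closed_cone_normalize_iff:
  assumes "closed_cone \<Gamma>" and "k \<noteq> 0"
  shows "(x, (1 / norm k) *\<^sub>R k) \<in> \<Gamma> \<longleftrightarrow> (x, k) \<in> \<Gamma>"
proof -
  have scale: "(x, t *\<^sub>R \<xi>) \<in> \<Gamma>" if "t > 0" "(x, \<xi>) \<in> \<Gamma>" for t \<xi>
    using assms(1) that by (auto simp: closed_cone_def)
  show ?thesis
    using scale[of "1 / norm k" k] scale[of "norm k" "(1 / norm k) *\<^sub>R k"] assms(2) by auto
qed

theorem lemma7p1:
  fixes \<Gamma> :: "((real ^ 'n) \<times> (real ^ 'n)) set" and K :: "(real ^ 'n) set"
  assumes "closed_cone \<Gamma>" and "compact K" and "K \<subseteq> Q_cube"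
  shows "(\<Union>j. \<Union>m\<in>centers j. \<Union>l\<in>{1..}. q j m \<times> C \<Gamma> K j m l) over_base K
           = UT over_base K - U_cone \<Gamma> K
       \<and> (\<Union>j. \<Union>m\<in>centers j. \<Union>l\<in>{1..}. q j m \<times> V \<Gamma> K j m l) over_base K
           = (T_dot - \<Gamma>) over_base K"
proof -
  have C_iff: "(\<exists>j. \<exists>m\<in>centers j. \<exists>l\<in>{1..}. x \<in> q j m \<and> \<eta> \<in> C \<Gamma> K j m l)
      \<longleftrightarrow> norm \<eta> = 1 \<and> (x, \<eta>) \<notin> \<Gamma>" (is "?L \<longleftrightarrow> ?R") if "x \<in> K" for x \<eta>
  proof
    show "?L \<Longrightarrow> ?R"
      using C_subset that by fastforce
    assume ?R
    moreover have "x \<in> Q_cube"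
      using that assms(3) by blast
    ultimately obtain j m l where "m \<in> centers j" "l \<ge> 1" "x \<in> q j m" "\<eta> \<in> C \<Gamma> K j m l"
      using ex_cube_C[OF assms(1)] by blast
    then show ?L
      by auto
  qed
  have V_iff: "(\<exists>j. \<exists>m\<in>centers j. \<exists>l\<in>{1..}. x \<in> q j m \<and> k \<in> V \<Gamma> K j m l)
      \<longleftrightarrow> k \<noteq> 0 \<and> (x, k) \<notin> \<Gamma>" if "x \<in> K" for x k
  proof (cases "k = 0")
    case True
    then show ?thesis
      by (simp add: V_def)
  next
    case False
    \<comment> \<open>\<open>V\<close> tests \<open>k\<close> through its normalisation, a unit
      covector, so \<open>C_iff\<close> applies to it and the cone property returns to
      \<open>k\<close>.\<close>
    then show ?thesis
      using C_iff[OF that, of "(1 / norm k) *\<^sub>R k"] closed_cone_normalize_iff[OF assms(1) False]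
      by (simp add: V_def)
  qed
  have mem_over_base: "(x, k) \<in> A over_base K \<longleftrightarrow> x \<in> K \<and> (x, k) \<in> A"
    for A and x k :: "real ^ 'n"
    by (auto simp: over_base_def)
  show ?thesis
  proof
    show "(\<Union>j. \<Union>m\<in>centers j. \<Union>l\<in>{1..}. q j m \<times> C \<Gamma> K j m l) over_base K
        = UT over_base K - U_cone \<Gamma> K"
    proof (rule set_eqI, clarify)
      fix x k :: "real ^ 'n"
      show "(x, k) \<in> (\<Union>j. \<Union>m\<in>centers j. \<Union>l\<in>{1..}. q j m \<times> C \<Gamma> K j m l) over_base K
          \<longleftrightarrow> (x, k) \<in> UT over_base K - U_cone \<Gamma> K"
        \<comment> \<open>Off \<open>K\<close> neither side has points. Over \<open>K\<close>, a
          unit covector is in \<open>U_cone\<close> exactly when it is in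
          \<open>\<Gamma>\<close>.\<close>
        using C_iff[of x k] by (cases "x \<in> K") (auto simp: mem_over_base UT_def U_cone_def)
    qed
    show "(\<Union>j. \<Union>m\<in>centers j. \<Union>l\<in>{1..}. q j m \<times> V \<Gamma> K j m l) over_base K
        = (T_dot - \<Gamma>) over_base K"
    proof (rule set_eqI, clarify)
      fix x k :: "real ^ 'n"
      show "(x, k) \<in> (\<Union>j. \<Union>m\<in>centers j. \<Union>l\<in>{1..}. q j m \<times> V \<Gamma> K j m l) over_base K
          \<longleftrightarrow> (x, k) \<in> (T_dot - \<Gamma>) over_base K"
        using V_iff[of x k] by (cases "x \<in> K") (auto simp: mem_over_base T_dot_def)
    qed
  qed
qed

end
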